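(* Let $\bar{\bm p}\in\mathbb R^n$ with $\bm 1^\top\bar{\bm p}=0$ be the nominal schedule, let $\widehat{\bm\mu}_r\in\mathbb R^n$ be the estimated residual mean, let $\bm m^\pm=(m_\ell^\pm)_{\ell\in\mathcal E}$ be calibrated line-loading margins, and let $[\widehat\delta^{\mathrm{low}},\widehat\delta^{\mathrm{up}}]$ be a calibrated aggregate-mismatch interval. Let $\Delta\bm p^\star$ be any feasible solution of the convex quadratic program in $\Delta\bm p\in\mathbb R^n$ (with $\Delta p_j=0$ at buses $j$ without controllable resources) $$\begin{aligned}\min\ &\|\Delta\bm p\|_2^2\\ \text{s.t. }&\bm 1^\top\Delta\bm p=0,\\ &\bm p^{\min}+\bm\alpha\,\widehat\delta^{\mathrm{up}}\le\bar{\bm p}+\Delta\bm p\le\bm p^{\max}+\bm\alpha\,\widehat\delta^{\mathrm{low}},\\ &-\bm 1+\bm m^-\le K(\bar{\bm p}+\Delta\bm p+\widehat{\bm\mu}_r)\le\bm 1-\bm m^+,\end{aligned}$$ and define $\bar{\bm p}^{c,\star}=\bar{\bm p}+\Delta\bm p^\star$. Suppose that the forecast-error distribution is exogenous to the schedule and that the same fixed AGC policy applies before and after re-dispatch, so that for a future forecast error $\bm\omega^{\mathrm{new}}$ the post-AGC residual is $\bm r^{\mathrm{new}}=(I-\bm\alpha\bm 1^\top)\bm\omega^{\mathrm{new}}$ and its distribution does not depend on the schedule. Let $\delta^{\mathrm{new}}=\bm 1^\top\bm\omega^{\mathrm{new}}$, and define the events $$\mathcal M_\ell(\bm r^{\mathrm{new}})=\left\{-m_\ell^-\le[K(\bm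 r^{\mathrm{new}}-\widehat{\bm\mu}_r)]_\ell\le m_\ell^+\right\},\quad \ell\in\mathcal E,\qquad \mathcal H^{\mathrm{new}}=\left\{\widehat\delta^{\mathrm{low}}\le\delta^{\mathrm{new}}\le\widehat\delta^{\mathrm{up}}\right\}.$$ Suppose that $\mathbb P(\mathcal M_\ell(\bm r^{\mathrm{new}})\mid\mathcal D_{\mathrm{tr}})\ge 1-\epsilon$ for each line $\ell\in\mathcal E$, and that $\mathbb P(\mathcal H^{\mathrm{new}}\mid\mathcal D_{\mathrm{tr}})\ge 1-\epsilon_{\mathrm H}$. Then, for every $\ell\in\mathcal E$, on $\mathcal M_\ell(\bm r^{\mathrm{new}})\cap\mathcal H^{\mathrm{new}}$ the prescribed AGC response remains unsaturated, i.e. $\bm p^{\min}\le\bar{\bm p}^{c,\star}-\bm\alpha\,\delta^{\mathrm{new}}\le\bm p^{\max}$, and $$-1\le\left[K(\bar{\bm p}^{c,\star}+\bm r^{\mathrm{new}})\right]_\ell\le 1.$$ Consequently, for every line $\ell\in\mathcal E$, $$\mathbb P\left(\ell\text{ is secure and AGC remains unsaturated}\right)\ge 1-\epsilon_{\mathrm H}-\epsilon,$$ where "$\ell$ is secure" means $-1\le[K(\bar{\bm p}^{c,\star}+\bm r^{\mathrm{new}})]_\ell\le 1$.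
   Context: Network: $\mathcal G=(\mathcal N,\mathcal E)$ is a connected graph with $n$ buses (nodes) and finitely many transmission lines (edges), each arbitrarily oriented. $A\in\mathbb R^{|\mathcal E|\times n}$ is the line-bus incidence matrix, $B=\operatorname{diag}(b_\ell)$ is the diagonal matrix of line susceptances, $L=A^\top BA$ is the weighted Laplacian (with $\operatorname{null}(L)=\operatorname{span}\{\bm 1\}$), $L^\dagger$ is its Moore--Penrose pseudo-inverse, $f_\ell^{\max}>0$ are thermal limits, $D=\operatorname{diag}(1/f_\ell^{\max})$, and $K=DBAL^\dagger\in\mathbb R^{|\mathcal E|\times n}$ is the injection-to-line-loading map (so a loading of absolute value at most $1$ means the thermal limit is respected). AGC policy: $\bm\alpha\in\mathbb R_+^n$ with $\bm 1^\top\bm\alpha=1$ is a fixed participation vector. In response to a forecast error $\bm\omega\in\mathbb R^n$ the AGC (automatic generation control) applies the adjustment $-\bm\alpha(\bm 1^\top\bm\omega)$. The vectors $\bm p^{\min},\bm p^{\max}\in\mathbb R^n$ are bus-level generation limits; AGC is unsaturated if the AGC-adjusted schedule stays within these limits. Vector inequalities are componentwise, and $\bm 1$ is an all-ones vector of the appropriate dimension. Randomness: $\mathcal D_{\mathrm{tr}}$ is the training data set. $\widehat{\bm\mu}_r$ is a function of $\mathcal D_{\mathrm{tr}}$; the margins $\bm m^\pm$ and the interval end points $\widehat\delta^{\mathrm{low}},\widehat\delta^{\mathrm{up}}$ are functions of the training data and of calibration data, and $\Delta\bm p^\star$ is a (measurable) choice of feasible point determined by these data. Probabilities are over the joint draw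 of all data and the future forecast error $\bm\omega^{\mathrm{new}}$. No independence of the events $\mathcal M_\ell(\bm r^{\mathrm{new}})$ and $\mathcal H^{\mathrm{new}}$ is assumed. *)

theory Defs
  imports "HOL-Probability.Probability" "Graph_Theory.Digraph_Component"
begin

(* The type 'n indexes the buses and 'e the lines, so vectors over buses and lines are real^'n and
   real^'e, and "1 :: real^'n" is the all-ones vector.  The order on real^'n is componentwise. *)

(* Every line is an arc of a directed multigraph; its direction is the arbitrary orientation.
   Parallel lines are allowed.  The qualified name avoids the topological notion "connected",
   and connectedness refers to the underlying undirected graph. *)
definition network :: "('n::finite, 'e::finite) pre_digraph \<Rightarrow> bool" where
  "network G \<longleftrightarrow>
     verts G = UNIV \<and> arcs G = UNIV \<and> loopfree_digraph G \<and> Digraph_Component.connected G"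

definition incidence :: "('n::finite, 'e::finite) pre_digraph \<Rightarrow> real^'n^'e" where
  "incidence G = (\<chi> l i. (if tail G l = i then 1 else 0) - (if head G l = i then 1 else 0))"

definition diag :: "real^'e \<Rightarrow> real^'e^'e" where
  "diag v = (\<chi> i j. if i = j then v $ i else 0)"

definition laplacian :: "('n::finite, 'e::finite) pre_digraph \<Rightarrow> real^'e \<Rightarrow> real^'n^'n" where
  "laplacian G b = transpose (incidence G) ** diag b ** incidence G"

definition is_pinv :: "real^'n^'m \<Rightarrow> real^'m^'n \<Rightarrow> bool" where
  "is_pinv A X \<longleftrightarrow> A ** X ** A = A \<and> X ** A ** X = X \<and>
     transpose (A ** X) = A ** X \<and> transpose (X ** A) = X ** A"

(* Moore-Penrose pseudo-inverse; well defined by ex1_pinv below. *)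
definition pinv :: "real^'n^'m \<Rightarrow> real^'m^'n" where
  "pinv A = (THE X. is_pinv A X)"

lemma pinv_unique:
  assumes "is_pinv A X" "is_pinv A Y"
  shows "X = Y"
proof -
  have AX: "A ** X = A ** Y"
  proof -
    have "A ** X = transpose (A ** Y ** (A ** X))"
      using assms unfolding is_pinv_def by (metis matrix_mul_assoc)
    also have "\<dots> = A ** X ** (A ** Y)"
      using assms unfolding is_pinv_def by (metis matrix_transpose_mul)
    also have "\<dots> = A ** Y"
      using assms unfolding is_pinv_def by (metis matrix_mul_assoc)
    finally show ?thesis .
  qed
  have XA: "X ** A = Y ** A"
  proof -
    have "X ** A = transpose (X ** A ** (Y ** A))"
      using assms unfolding is_pinv_def by (metis matrix_mul_assoc)
    also have "\<dots> = Y ** A ** (X ** A)"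
      using assms unfolding is_pinv_def by (metis matrix_transpose_mul)
    also have "\<dots> = Y ** A"
      using assms unfolding is_pinv_def by (metis matrix_mul_assoc)
    finally show ?thesis .
  qed
  show ?thesis
    using assms AX XA unfolding is_pinv_def by (metis matrix_mul_assoc)
qed

lemma orth_projection_exists:
  fixes V :: "(real^'n) set"
  assumes "subspace V"
  obtains P where "linear P" "\<And>x. P x \<in> V" "\<And>x. x \<in> V \<Longrightarrow> P x = x"
    "\<And>x y. P x \<bullet> y = x \<bullet> P y"
proof -
  obtain B where B: "B \<subseteq> V" "pairwise orthogonal B" "\<And>x. x \<in> B \<Longrightarrow> norm x = 1"
      "independent B" "span B = V"
    using orthonormal_basis_subspace[OF assms] by metis
  have fin: "finite B" using B(4) independent_imp_finite by blast
  define P where "P x = (\<Sum>b\<in>B. (x \<bullet> b) *\<^sub>R b)" for x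
  have lin: "linear P"
    unfolding P_def by (intro linearI)
      (simp_all add: inner_add_left scaleR_add_left sum.distrib scaleR_sum_right)
  have Pb: "P c = c" if "c \<in> B" for c
  proof -
    have "(c \<bullet> b) *\<^sub>R b = (if b = c then c else 0)" if "b \<in> B" for b
      using B(2,3) \<open>c \<in> B\<close> that by (auto simp: pairwise_def orthogonal_def norm_eq_1)
    then have "P c = (\<Sum>b\<in>B. if b = c then c else 0)" unfolding P_def by (intro sum.cong) auto
    then show ?thesis using fin that by simp
  qed
  have "P x = x" if "x \<in> V" for x
    using that linear_eq_on[OF lin linear_id, of x B] Pb B(5) by auto
  moreover have "P x \<in> V" for x
    unfolding P_def using assms B(1) by (auto intro!: subspace_sum subspace_scale)
  moreover have "P x \<bullet> y = x \<bullet> P y" for x y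
    unfolding P_def by (simp add: inner_sum_left inner_sum_right inner_commute mult.commute)
  ultimately show ?thesis using that lin by blast
qed

lemma transpose_eq_self:
  fixes A :: "real^'n^'n"
  assumes "\<And>x y. (A *v x) \<bullet> y = x \<bullet> (A *v y)"
  shows "transpose A = A"
  by (metis assms adjoint_unique adjoint_matrix matrix_of_matrix_vector_mul)

lemma ex1_pinv: "\<exists>!X. is_pinv (A :: real^'n^'m) X"
proof -
  let ?f = "(*v) A"
  obtain P where P: "linear P" "\<And>x. P x \<in> range ?f" "\<And>x. x \<in> range ?f \<Longrightarrow> P x = x"
      "\<And>x y. P x \<bullet> y = x \<bullet> P y"
    using orth_projection_exists[of "range ?f"]
    by (metis linear_subspace_image matrix_vector_mul_linear subspace_UNIV)
  have subR: "subspace (range ((*v) (transpose A)))"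
    by (metis linear_subspace_image matrix_vector_mul_linear subspace_UNIV)
  obtain Q where Q: "linear Q" "\<And>x. Q x \<in> range ((*v) (transpose A))"
      "\<And>x. x \<in> range ((*v) (transpose A)) \<Longrightarrow> Q x = x" "\<And>x y. Q x \<bullet> y = x \<bullet> Q y"
    using orth_projection_exists[OF subR] by metis
  have adj: "(A *v x) \<bullet> y = x \<bullet> (transpose A *v y)" for x y
    by (metis adjoint_matrix adjoint_works matrix_vector_mul_linear)
  have AQ: "A *v Q x = A *v x" for x
  proof -
    have "(A *v (Q x - x)) \<bullet> y = 0" for y
      using Q(3,4)[of "transpose A *v y"] Q(4)[of x "transpose A *v y"]
      by (simp add: adj inner_diff_left)
    then have "A *v (Q x - x) = 0" using inner_eq_zero_iff by blast
    then show ?thesis by (simp add: matrix_vector_mult_diff_distrib)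
  qed
  have inj: "inj_on ?f (range ((*v) (transpose A)))"
  proof (subst linear_inj_on_iff_eq_0)
    show "linear ?f" "subspace (range ((*v) (transpose A)))"
      using subR by (auto simp: matrix_vector_mul_linear)
    show "\<forall>x\<in>range ((*v) (transpose A)). A *v x = 0 \<longrightarrow> x = 0"
    proof clarify
      fix y assume "A *v (transpose A *v y) = 0"
      then have "(transpose A *v y) \<bullet> (transpose A *v y) = 0" by (metis adj inner_zero_left)
      then show "transpose A *v y = 0" by simp
    qed
  qed
  obtain g where g: "g \<in> UNIV \<rightarrow> range ((*v) (transpose A))" "linear g"
      "\<And>v. v \<in> range ((*v) (transpose A)) \<Longrightarrow> g (A *v v) = v"
    using linear_exists_left_inverse_on[OF matrix_vector_mul_linear[of A] subR inj]
    by auto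
  have gA: "g (A *v x) = Q x" for x using g(3)[OF Q(2)[of x]] AQ by simp
  define X where "X = matrix (g \<circ> P)"
  have X: "X *v y = g (P y)" for y
    using linear_compose[OF P(1) g(2)] by (simp add: X_def matrix_works linear_matrix_vector_mul_eq)
  have XA: "X *v (A *v x) = Q x" for x using X P(3) gA by simp
  have AX: "A *v (X *v y) = P y" for y
  proof -
    obtain x where "P y = A *v x" using P(2)[of y] by auto
    then show ?thesis using X gA AQ by simp
  qed
  have XP: "X *v P y = X *v y" for y using X P(2,3) by simp
  have "is_pinv A X"
    unfolding is_pinv_def
  proof (intro conjI)
    show "A ** X ** A = A"
      by (simp add: matrix_eq matrix_vector_mul_assoc[symmetric] XA AQ)
    show "X ** A ** X = X"
      by (simp add: matrix_eq matrix_vector_mul_assoc[symmetric] AX XP)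
    show "transpose (A ** X) = A ** X"
      by (rule transpose_eq_self) (simp add: matrix_vector_mul_assoc[symmetric] AX P(4))
    show "transpose (X ** A) = X ** A"
      by (rule transpose_eq_self) (simp add: matrix_vector_mul_assoc[symmetric] XA Q(4))
  qed
  then show ?thesis using pinv_unique by blast
qed

definition line_loading_map ::
    "('n::finite, 'e::finite) pre_digraph \<Rightarrow> real^'e \<Rightarrow> real^'e \<Rightarrow> real^'n^'e" where
  "line_loading_map G b fmax =
     diag (\<chi> l. 1 / fmax $ l) ** diag b ** incidence G ** pinv (laplacian G b)"

(* Feasible set of the quadratic program; C is the set of buses with controllable resources.
   The objective (the squared Euclidean norm of dp) does not restrict feasibility. *)
definition redispatch_feasible ::
    "real^'n^'e \<Rightarrow> 'n set \<Rightarrow> real^'n \<Rightarrow> real^'n \<Rightarrow> real^'n \<Rightarrow> real^'n \<Rightarrow> real^'n \<Rightarrow>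
     real^'e \<Rightarrow> real^'e \<Rightarrow> real \<Rightarrow> real \<Rightarrow> (real^'n) set" where
  "redispatch_feasible K C \<alpha> pmin pmax pbar mu mminus mplus dlow dup =
     {dp. (\<forall>j. j \<notin> C \<longrightarrow> dp $ j = 0) \<and>
          1 \<bullet> dp = 0 \<and>
          pmin + dup *\<^sub>R \<alpha> \<le> pbar + dp \<and> pbar + dp \<le> pmax + dlow *\<^sub>R \<alpha> \<and>
          - 1 + mminus \<le> K *v (pbar + dp + mu) \<and> K *v (pbar + dp + mu) \<le> 1 - mplus}"

definition agc_residual :: "real^'n \<Rightarrow> real^'n \<Rightarrow> real^'n" where
  "agc_residual \<alpha> \<omega> = (mat 1 - (\<chi> i j. \<alpha> $ i * (1::real^'n) $ j)) *v \<omega>"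

definition agc_unsaturated :: "real^'n \<Rightarrow> real^'n \<Rightarrow> real^'n \<Rightarrow> real^'n \<Rightarrow> real \<Rightarrow> bool" where
  "agc_unsaturated pmin pmax \<alpha> p \<delta> \<longleftrightarrow> pmin \<le> p - \<delta> *\<^sub>R \<alpha> \<and> p - \<delta> *\<^sub>R \<alpha> \<le> pmax"

definition line_secure :: "real^'n^'e \<Rightarrow> real^'n \<Rightarrow> real^'n \<Rightarrow> 'e \<Rightarrow> bool" where
  "line_secure K p r l \<longleftrightarrow> - 1 \<le> (K *v (p + r)) $ l \<and> (K *v (p + r)) $ l \<le> 1"

(* P(A | X): a version of the conditional expectation of the indicator of A given the
   sigma-algebra generated by X; like any version, it is determined almost everywhere only. *)
definition prob_given :: "'w measure \<Rightarrow> 'd measure \<Rightarrow> ('w \<Rightarrow> 'd) \<Rightarrow> 'w set \<Rightarrow> 'w \<Rightarrow> real" where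
  "prob_given M S X A = real_cond_exp M (vimage_algebra (space M) X S) (indicator A)"

end

theory Submission
  imports Defs
begin

text \<open>
  On both events the claim is deterministic: since \<open>\<alpha> \<ge> 0\<close>, the interval bounds on
  \<open>\<delta>\<close> absorb the AGC tightening, and
  \<open>K (p + r) = K (p + \<mu>) + K (r - \<mu>)\<close> lets the margins absorb the residual. For the
  probability, integrate the two conditional bounds and apply the union bound to the complements.
\<close>

text \<open>Law of total expectation: any version of the conditional probability integrates to
  \<open>prob A\<close>, and an almost sure lower bound survives integration against a measure of
  total mass one.\<close>

lemma (in prob_space) prob_ge_prob_given:
  assumes X: "X \<in> measurable M S" and A: "A \<in> sets M"
    and ge: "AE w in M. prob_given M S X A w \<ge> c"
  shows "prob A \<ge> c"
proof -
  let ?F = "vimage_algebra (space M) X S"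
  \<comment> \<open>Measurability of \<open>X\<close> enters here. Since \<open>M\<close> is finite,
    so is its restriction to \<open>?F\<close>, and the facts about \<open>real_cond_exp\<close>
    become available.\<close>
  have "subalgebra M ?F"
    using X by (auto simp: subalgebra_def sets_vimage_algebra2 measurable_space
        intro: measurable_sets)
  then interpret finite_measure_subalgebra M ?F
    by unfold_locales
  have ind: "integrable M (indicator A :: _ \<Rightarrow> real)"
    using A by (intro integrable_real_indicator) (simp_all add: emeasure_eq_measure)
  have "c \<le> expectation (prob_given M S X A)"
    using ge integral_ge_const[of "prob_given M S X A" c] real_cond_exp_int(1)[OF ind]
    by (simp add: prob_given_def)
  also have "\<dots> = prob A"
    using real_cond_exp_int(2)[OF ind] A by (simp add: prob_given_def)
  finally show ?thesis .
qed

text \<open>Only the two marginal probabilities enter, so the events may depend on each other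
  arbitrarily.\<close>

lemma (in prob_space) prob_Int_ge:
  assumes A: "A \<in> events" and B: "B \<in> events"
    and "prob A \<ge> 1 - a" "prob B \<ge> 1 - b"
  shows "prob (A \<inter> B) \<ge> 1 - a - b"
proof -
  have "prob (space M - A \<inter> B) \<le> prob (space M - A) + prob (space M - B)"
    using measure_Un_le[of "space M - A" M "space M - B"] A B by (simp add: Diff_Int)
  then show ?thesis
    using assms prob_compl[OF A] prob_compl[OF B] prob_compl[of "A \<inter> B"] by auto
qed

text \<open>As \<open>\<delta>\<close> grows, the schedule after AGC can only fall, because
  \<open>0 \<le> \<alpha>\<close>. Hence \<open>dup\<close> is the worst case for
  \<open>pmin\<close> and \<open>dlow\<close> for \<open>pmax\<close>, which is how the program
  pairs them.\<close>

lemma redispatch_feasible_unsaturated: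
  assumes "dp \<in> redispatch_feasible K C \<alpha> pmin pmax pbar mu mminus mplus dlow dup"
    and "0 \<le> \<alpha>" "dlow \<le> \<delta>" "\<delta> \<le> dup"
  shows "agc_unsaturated pmin pmax \<alpha> (pbar + dp) \<delta>"
proof -
  have "pmin $ i \<le> pbar $ i + dp $ i - \<delta> * \<alpha> $ i \<and> pbar $ i + dp $ i - \<delta> * \<alpha> $ i \<le> pmax $ i"
    for i
  proof -
    have "dlow * \<alpha> $ i \<le> \<delta> * \<alpha> $ i" "\<delta> * \<alpha> $ i \<le> dup * \<alpha> $ i"
      using assms(2-4) by (auto simp: less_eq_vec_def intro: mult_right_mono)
    moreover have "pmin $ i + dup * \<alpha> $ i \<le> pbar $ i + dp $ i"
        "pbar $ i + dp $ i \<le> pmax $ i + dlow * \<alpha> $ i"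
      using assms(1) by (simp_all add: redispatch_feasible_def less_eq_vec_def)
    ultimately show ?thesis by linarith
  qed
  then show ?thesis by (simp add: agc_unsaturated_def less_eq_vec_def)
qed

text \<open>The program constrains the loading with \<open>mu\<close> in place of \<open>r\<close>;
  the error of this substitution is \<open>K *v (r - mu)\<close>. Each margin cancels the tightening
  on its own side, and only component \<open>l\<close> is involved.\<close>

lemma redispatch_feasible_secure:
  assumes "dp \<in> redispatch_feasible K C \<alpha> pmin pmax pbar mu mminus mplus dlow dup"
    and "- mminus $ l \<le> (K *v (r - mu)) $ l" "(K *v (r - mu)) $ l \<le> mplus $ l"
  shows "line_secure K (pbar + dp) r l"
proof -
  have "K *v (pbar + dp + r) = K *v (pbar + dp + mu) + K *v (r - mu)"
    by (simp add: add.assoc flip: matrix_vector_right_distrib)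
  moreover have "- 1 + mminus $ l \<le> (K *v (pbar + dp + mu)) $ l"
      "(K *v (pbar + dp + mu)) $ l \<le> 1 - mplus $ l"
    using assms(1) by (auto simp: redispatch_feasible_def less_eq_vec_def)
  ultimately show ?thesis
    using assms(2,3) by (simp add: line_secure_def)
qed

text \<open>Linear maps in finite dimension are continuous. This rule and the next one let
  \<open>measurable\<close> handle the loadings in the events.\<close>

lemma borel_measurable_matrix_vector_mult [measurable (raw)]:
  fixes A :: "real^'n^'m"
  assumes "f \<in> borel_measurable M"
  shows "(\<lambda>x. A *v f x) \<in> borel_measurable M"
  using assms by (rule borel_measurable_continuous_on[OF matrix_vector_mult_linear_continuous_on])

lemma borel_measurable_vec_nth_comp [measurable (raw)]:
  fixes f :: "'a \<Rightarrow> real^'n"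
  assumes "f \<in> borel_measurable M"
  shows "(\<lambda>x. f x $ i) \<in> borel_measurable M"
  using assms by (rule borel_measurable_continuous_on[OF continuous_on_component[OF continuous_on_id]])

theorem theorem1:
  fixes G :: "('n::finite, 'e::finite) pre_digraph"
    and b fmax :: "real^'e"
    and K :: "real^'n^'e"
    and \<alpha> pmin pmax pbar :: "real^'n"
    and controllable :: "'n set"
    and M :: "'w measure" and S :: "'d measure" and T :: "'c measure"
    and Dtr :: "'w \<Rightarrow> 'd" and Dcal :: "'w \<Rightarrow> 'c"
    and mu :: "'d \<Rightarrow> real^'n"
    and mminus mplus :: "'d \<times> 'c \<Rightarrow> real^'e"
    and dlow dup :: "'d \<times> 'c \<Rightarrow> real"
    and dp :: "'d \<times> 'c \<Rightarrow> real^'n"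
    and err :: "real^'n \<Rightarrow> 'w \<Rightarrow> real^'n"
    and pc \<omega>_new r_new :: "'w \<Rightarrow> real^'n"
    and \<delta>_new :: "'w \<Rightarrow> real"
    and margin_event :: "'e \<Rightarrow> 'w set" and mismatch_event :: "'w set"
    and \<epsilon> \<epsilon>H :: real
  assumes network: "network G"
    and null_L: "{x. laplacian G b *v x = 0} = span {1}"
    and fmax: "\<And>l. fmax $ l > 0"
    and K: "K = line_loading_map G b fmax"
    and \<alpha>: "0 \<le> \<alpha>" "1 \<bullet> \<alpha> = 1"
    and pbar: "1 \<bullet> pbar = 0"
    and M: "prob_space M"
    and Dtr: "Dtr \<in> measurable M S"
    and Dcal: "Dcal \<in> measurable M T"
    and mu: "mu \<in> borel_measurable S"
    and margins: "mminus \<in> borel_measurable (S \<Otimes>\<^sub>M T)" "mplus \<in> borel_measurable (S \<Otimes>\<^sub>M T)"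
    and interval: "dlow \<in> borel_measurable (S \<Otimes>\<^sub>M T)" "dup \<in> borel_measurable (S \<Otimes>\<^sub>M T)"
    and dp: "dp \<in> borel_measurable (S \<Otimes>\<^sub>M T)"
    and feasible: "\<And>w. w \<in> space M \<Longrightarrow>
          dp (Dtr w, Dcal w) \<in> redispatch_feasible K controllable \<alpha> pmin pmax pbar (mu (Dtr w))
            (mminus (Dtr w, Dcal w)) (mplus (Dtr w, Dcal w))
            (dlow (Dtr w, Dcal w)) (dup (Dtr w, Dcal w))"
    and pc: "\<And>w. pc w = pbar + dp (Dtr w, Dcal w)"
      (* err s is the future forecast error when s is the schedule; exogeneity: its law does not
         depend on s *)
    and err: "\<And>s. err s \<in> borel_measurable M"
    and exogenous: "\<And>s s'. distr M borel (err s) = distr M borel (err s')"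
    and \<omega>_new: "\<And>w. \<omega>_new w = err (pc w) w" "\<omega>_new \<in> borel_measurable M"
    and r_new: "\<And>w. r_new w = agc_residual \<alpha> (\<omega>_new w)"
    and \<delta>_new: "\<And>w. \<delta>_new w = 1 \<bullet> \<omega>_new w"
    and margin_event: "\<And>l. margin_event l = {w \<in> space M.
          - mminus (Dtr w, Dcal w) $ l \<le> (K *v (r_new w - mu (Dtr w))) $ l \<and>
          (K *v (r_new w - mu (Dtr w))) $ l \<le> mplus (Dtr w, Dcal w) $ l}"
    and mismatch_event: "mismatch_event = {w \<in> space M.
          dlow (Dtr w, Dcal w) \<le> \<delta>_new w \<and> \<delta>_new w \<le> dup (Dtr w, Dcal w)}"
    and prob_margin: "\<And>l. AE w in M. prob_given M S Dtr (margin_event l) w \<ge> 1 - \<epsilon>"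
    and prob_mismatch: "AE w in M. prob_given M S Dtr mismatch_event w \<ge> 1 - \<epsilon>H"
  shows "(\<forall>l. \<forall>w \<in> margin_event l \<inter> mismatch_event.
            agc_unsaturated pmin pmax \<alpha> (pc w) (\<delta>_new w) \<and> line_secure K (pc w) (r_new w) l)
       \<and> (\<forall>l. measure M {w \<in> space M. line_secure K (pc w) (r_new w) l \<and>
                                  agc_unsaturated pmin pmax \<alpha> (pc w) (\<delta>_new w)}
              \<ge> 1 - \<epsilon>H - \<epsilon>)"
proof -
  interpret prob_space M by fact
  note [measurable] = Dtr Dcal mu margins interval dp \<omega>_new(2)
  have r_meas [measurable]: "r_new \<in> borel_measurable M"
    unfolding r_new agc_residual_def by measurable
  have \<delta>_meas [measurable]: "\<delta>_new \<in> borel_measurable M"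
    unfolding \<delta>_new by measurable
  have pc_meas [measurable]: "pc \<in> borel_measurable M"
    unfolding pc by measurable
  have margin_sets: "margin_event l \<in> events" for l
    unfolding margin_event by measurable
  have mismatch_sets: "mismatch_event \<in> events"
    unfolding mismatch_event by measurable
  \<comment> \<open>The argument is pathwise: at a fixed outcome \<open>w\<close>, the margins, the
    interval and the chosen schedule are constants.\<close>
  have good: "agc_unsaturated pmin pmax \<alpha> (pc w) (\<delta>_new w) \<and> line_secure K (pc w) (r_new w) l"
    if w: "w \<in> margin_event l \<inter> mismatch_event" for w l
  proof -
    have "w \<in> space M" using w by (simp add: mismatch_event)
    then show ?thesis
      using w \<alpha>(1) unfolding pc margin_event mismatch_event
      by (auto intro: redispatch_feasible_unsaturated[OF feasible]
          redispatch_feasible_secure[OF feasible])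
  qed
  have "prob {w \<in> space M. line_secure K (pc w) (r_new w) l \<and>
          agc_unsaturated pmin pmax \<alpha> (pc w) (\<delta>_new w)} \<ge> 1 - \<epsilon>H - \<epsilon>" (is "prob ?A \<ge> _") for l
  proof -
    \<comment> \<open>The mismatch event comes first so that the losses are subtracted in the order
      of the claim.\<close>
    have "1 - \<epsilon>H - \<epsilon> \<le> prob (mismatch_event \<inter> margin_event l)"
      using prob_ge_prob_given[OF Dtr] margin_sets mismatch_sets prob_margin prob_mismatch
      by (intro prob_Int_ge) auto
    also have "\<dots> \<le> prob ?A"
    proof (rule finite_measure_mono)
      show "mismatch_event \<inter> margin_event l \<subseteq> ?A"
        using good by (auto simp: mismatch_event)
      \<comment> \<open>Monotonicity of the measure needs the larger set to be measurable; unfolding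
        the componentwise order leaves finitely many real inequalities.\<close>
      show "?A \<in> events"
        unfolding line_secure_def agc_unsaturated_def less_eq_vec_def by measurable
    qed
    finally show ?thesis .
  qed
  with good show ?thesis by blast
qed

end
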